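(* Let $\mathcal H$ be a complex separable Hilbert space and $T:\mathcal H\to\mathcal H$ an isometry. Suppose that $\mathcal H=\mathcal M\oplus\mathcal M^\perp$, where $T|_{\mathcal M}:\mathcal M\to\mathcal M$ is a shift (unilateral or bilateral) and $T|_{\mathcal M^\perp}:\mathcal M^\perp\to\mathcal M^\perp$ is the identity operator. Let $\Pi_{\mathcal M^\perp}$ be the orthogonal projection of $\mathcal H$ onto $\mathcal M^\perp$. Then for every sequence of positive numbers $(\varepsilon_n)$ with $\varepsilon_n\to0$ as $n\to+\infty$ there exists $f\in\mathcal H$ such that \[ \limsup_{N\to+\infty}\ \varepsilon_N^{-1}\,\bigg\|\frac1N\sum_{n=0}^{N-1}T^nf-\Pi_{\mathcal M^\perp}f\bigg\|_{\mathcal H}=+\infty . \]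
   Context: Isometry means a bounded linear operator $T$ with $\langle Tf,Tg\rangle=\langle f,g\rangle$ for all $f,g$. Subspaces are closed. An isometry $T:\mathcal M\to\mathcal M$ is a unilateral shift if there is a subspace $\mathcal V\subseteq\mathcal M$ (a generating wandering subspace) such that $T^m(\mathcal V)\perp T^n(\mathcal V)$ for all $m\ne n$ in $\mathbb N\cup\{0\}$ and $\mathcal M=\bigoplus_{k\in\mathbb N\cup\{0\}}T^k(\mathcal V)$. A unitary operator $T:\mathcal M\to\mathcal M$ is a bilateral shift if there is a subspace $\mathcal V\subseteq\mathcal M$ (a generating wandering subspace) such that $T^m(\mathcal V)\perp T^n(\mathcal V)$ for all $m\neq n$ in $\mathbb Z$ and $\mathcal M=\bigoplus_{k\in\mathbb Z}T^k(\mathcal V)$.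
   Formalization: The subspace M is assumed to be nonzero: for M = {0}, which the literal definition of a shift allows, T is the identity, the averages equal the projection and the limsup is 0 for every f, so the claim fails. *)

theory Defs
  imports "HOL-Analysis.Analysis"
begin

text \<open>
  Complex Hilbert spaces. The inner product is linear in its first argument. The real vector
  space structure inherited from \<^class>\<open>banach\<close> is the restriction of the complex one.
\<close>

class complex_hilbert_space = banach +
  fixes scaleC :: "complex \<Rightarrow> 'a \<Rightarrow> 'a"  (infixr \<open>*\<^sub>C\<close> 75)
    and cinner :: "'a \<Rightarrow> 'a \<Rightarrow> complex"
  assumes scaleC_add_right: "a *\<^sub>C (x + y) = a *\<^sub>C x + a *\<^sub>C y"
    and scaleC_add_left: "(a + b) *\<^sub>C x = a *\<^sub>C x + b *\<^sub>C x"
    and scaleC_scaleC: "a *\<^sub>C (b *\<^sub>C x) = (a * b) *\<^sub>C x"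
    and scaleC_of_real: "complex_of_real r *\<^sub>C x = r *\<^sub>R x"
    and cinner_commute: "cinner x y = cnj (cinner y x)"
    and cinner_add_left: "cinner (x + y) z = cinner x z + cinner y z"
    and cinner_scaleC_left: "cinner (a *\<^sub>C x) y = a * cinner x y"
    and cinner_nonneg: "0 \<le> Re (cinner x x)"
    and cinner_eq_zero_iff: "cinner x x = 0 \<longleftrightarrow> x = 0"
    and norm_eq_sqrt_cinner: "norm x = sqrt (Re (cinner x x))"

lemma scaleC_one: "1 *\<^sub>C x = (x :: 'a :: complex_hilbert_space)"
  using scaleC_of_real[of 1 x] by simp

global_interpretation complex_vector:
  vector_space "scaleC :: complex \<Rightarrow> 'a \<Rightarrow> 'a :: complex_hilbert_space"
  defines csubspace = complex_vector.subspace
  by unfold_locales (simp_all add: scaleC_add_right scaleC_add_left scaleC_scaleC scaleC_one)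

instantiation complex :: complex_hilbert_space
begin

definition scaleC_complex :: "complex \<Rightarrow> complex \<Rightarrow> complex"
  where "scaleC_complex a x = a * x"

definition cinner_complex :: "complex \<Rightarrow> complex \<Rightarrow> complex"
  where "cinner_complex x y = x * cnj y"

instance
  by standard
    (auto simp: scaleC_complex_def cinner_complex_def algebra_simps scaleR_conv_of_real
      cmod_def power2_eq_square)

end

definition closed_csubspace :: "'a :: complex_hilbert_space set \<Rightarrow> bool"
  where "closed_csubspace S \<longleftrightarrow> csubspace S \<and> closed S"

definition orthogonal_sets :: "'a :: complex_hilbert_space set \<Rightarrow> 'a set \<Rightarrow> bool"
  where "orthogonal_sets A B \<longleftrightarrow> (\<forall>x\<in>A. \<forall>y\<in>B. cinner x y = 0)"

definition orth_compl :: "'a :: complex_hilbert_space set \<Rightarrow> 'a set"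
  where "orth_compl S = {x. \<forall>y\<in>S. cinner x y = 0}"

text \<open>Meaningful if every \<open>x\<close> has such a decomposition; the point \<open>y\<close> is then unique.\<close>

definition orth_proj :: "'a :: complex_hilbert_space set \<Rightarrow> 'a \<Rightarrow> 'a"
  where "orth_proj S x = (THE y. y \<in> S \<and> x - y \<in> orth_compl S)"

text \<open>
  An operator on a subspace \<open>M\<close> is represented by a function on the ambient space of which only
  the values on \<open>M\<close> matter.
\<close>

definition isometry_on :: "'a :: complex_hilbert_space set \<Rightarrow> ('a \<Rightarrow> 'a) \<Rightarrow> bool"
  where "isometry_on M T \<longleftrightarrow>
    T ` M \<subseteq> M \<and>
    (\<forall>x\<in>M. \<forall>y\<in>M. T (x + y) = T x + T y) \<and>
    (\<forall>a. \<forall>x\<in>M. T (a *\<^sub>C x) = a *\<^sub>C T x) \<and>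
    (\<exists>K. \<forall>x\<in>M. norm (T x) \<le> K * norm x) \<and>
    (\<forall>x\<in>M. \<forall>y\<in>M. cinner (T x) (T y) = cinner x y)"

definition unitary_on :: "'a :: complex_hilbert_space set \<Rightarrow> ('a \<Rightarrow> 'a) \<Rightarrow> bool"
  where "unitary_on M T \<longleftrightarrow> isometry_on M T \<and> T ` M = M"

definition int_power_on :: "'a set \<Rightarrow> ('a \<Rightarrow> 'a) \<Rightarrow> int \<Rightarrow> 'a \<Rightarrow> 'a"
  where "int_power_on M T k =
    (if 0 \<le> k then T ^^ nat k else inv_into M T ^^ nat (- k))"

text \<open>
  \<open>M\<close> is the Hilbert space direct sum of the pairwise orthogonal family \<open>S\<close>: it consists of the
  sums of the unconditionally convergent series with terms in the \<open>S k\<close>. For orthogonal terms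
  in a Hilbert space, convergence of the series amounts to square-summability of the norms.
\<close>

definition is_orth_sum :: "'i set \<Rightarrow> ('i \<Rightarrow> 'a :: complex_hilbert_space set) \<Rightarrow> 'a set \<Rightarrow> bool"
  where "is_orth_sum I S M \<longleftrightarrow>
    (\<forall>m\<in>I. \<forall>n\<in>I. m \<noteq> n \<longrightarrow> orthogonal_sets (S m) (S n)) \<and>
    M = {x. \<exists>f. (\<forall>k\<in>I. f k \<in> S k) \<and> (f has_sum x) I}"

text \<open>The witness \<open>V\<close> in the next two definitions is the generating wandering subspace.
  The zero operator on \<open>{0}\<close> is admitted by both, with \<open>V = {0}\<close>.\<close>

definition unilateral_shift_on :: "'a :: complex_hilbert_space set \<Rightarrow> ('a \<Rightarrow> 'a) \<Rightarrow> bool"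
  where "unilateral_shift_on M T \<longleftrightarrow>
    isometry_on M T \<and>
    (\<exists>V\<subseteq>M. closed_csubspace V \<and> is_orth_sum (UNIV :: nat set) (\<lambda>k. (T ^^ k) ` V) M)"

definition bilateral_shift_on :: "'a :: complex_hilbert_space set \<Rightarrow> ('a \<Rightarrow> 'a) \<Rightarrow> bool"
  where "bilateral_shift_on M T \<longleftrightarrow>
    unitary_on M T \<and>
    (\<exists>V\<subseteq>M. closed_csubspace V \<and>
      is_orth_sum (UNIV :: int set) (\<lambda>k. int_power_on M T k ` V) M)"

end

theory Submission
  imports Defs "HOL-Real_Asymp.Real_Asymp"
begin

text \<open>
  Let \<open>e\<close> be a unit vector of the wandering subspace, so that the orbit \<open>T\<^sup>k e\<close> is orthonormal,
  and let \<open>g\<^sub>N\<close> be the unit vector \<open>N\<^bsup>-1/2\<^esup> (e + T e + \<dots> + T\<^bsup>N-1\<^esup> e)\<close>. The \<open>N\<close>-th ergodic average of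
  \<open>g\<^sub>N\<close> has norm at least \<open>1/2\<close>. Take \<open>f = \<Sum>\<^sub>i 2\<^bsup>-i\<^esup> g\<^bsub>N(i)\<^esub>\<close> with \<open>N(i)\<close> growing so fast that
  \<open>\<epsilon>\<^bsub>N(i)\<^esub> \<le> 4\<^bsup>-i\<^esup>\<close>. All coefficients in the orbit basis are nonnegative, so the summands cannot cancel
  and the \<open>N(i)\<close>-th average of \<open>f\<close> has norm at least \<open>2\<^bsup>-i\<^esup>/2\<close>.
\<close>

section \<open>Inner product identities and the Cauchy-Schwarz inequality\<close>

lemma cinner_add_right:
  "cinner x (y + z) = cinner x y + cinner x (z :: 'a :: complex_hilbert_space)"
  by (metis cinner_add_left cinner_commute complex_cnj_add)

lemma cinner_scaleR_left: "cinner (r *\<^sub>R x) y = complex_of_real r * cinner x y"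
  by (metis cinner_scaleC_left scaleC_of_real)

lemma cinner_scaleR_right: "cinner x (r *\<^sub>R y) = complex_of_real r * cinner x y"
  by (metis cinner_commute cinner_scaleR_left complex_cnj_complex_of_real complex_cnj_mult)

lemma cinner_zero_left: "cinner 0 y = 0"
  using cinner_scaleR_left[of 0 0 y] by simp

lemma cinner_diff_left: "cinner (x - y) z = cinner x z - cinner y z"
  using cinner_add_left[of "x - y" y z] by simp

lemma cinner_sum_left: "cinner (sum f A) y = (\<Sum>i\<in>A. cinner (f i) y)"
  by (induction A rule: infinite_finite_induct) (auto simp: cinner_zero_left cinner_add_left)

lemma cinner_sum_right: "cinner y (sum f A) = (\<Sum>i\<in>A. cinner y (f i))"
  by (subst cinner_commute) (simp add: cinner_sum_left cinner_commute[of y])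

lemma norm_power2_eq_cinner: "(norm x)\<^sup>2 = Re (cinner x x)"
  by (simp add: norm_eq_sqrt_cinner cinner_nonneg)

lemma Re_cinner_le_norm: "\<bar>Re (cinner x y)\<bar> \<le> norm x * norm y"
proof (cases "y = 0")
  case True
  then show ?thesis
    using cinner_scaleR_right[of x 0 0] by simp
next
  case False
  define c where "c = Re (cinner x y)"
  have yx: "Re (cinner y x) = c"
    unfolding c_def by (subst cinner_commute) simp
  \<comment> \<open>The vector is the residual of projecting \<open>x\<close> onto the real line
    through \<open>y\<close>, multiplied by \<open>(norm y)\<^sup>2\<close> to avoid
    division.\<close>
  have "0 \<le> (norm ((norm y)\<^sup>2 *\<^sub>R x + (- c) *\<^sub>R y))\<^sup>2"
    by simp
  also have "\<dots> = (norm y)\<^sup>2 * ((norm x)\<^sup>2 * (norm y)\<^sup>2 - c\<^sup>2)"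
    unfolding norm_power2_eq_cinner cinner_add_left cinner_add_right
      cinner_scaleR_left cinner_scaleR_right
    by (simp add: yx c_def[symmetric] algebra_simps power2_eq_square)
  finally have "c\<^sup>2 \<le> (norm x * norm y)\<^sup>2"
    using False by (simp add: zero_le_mult_iff power_mult_distrib)
  then show ?thesis
    unfolding c_def[symmetric] by (metis abs_le_square_iff abs_mult abs_norm_cancel)
qed

lemma bounded_linear_Re_cinner_left: "bounded_linear (\<lambda>x. Re (cinner x y))"
  by (rule bounded_linear_intro[where K = "norm y"])
    (use Re_cinner_le_norm[of _ y] in \<open>auto simp: cinner_add_left cinner_scaleR_left\<close>)

section \<open>Isometries and their iterates\<close>

lemma isometry_on_bounded_linear:
  assumes "isometry_on UNIV T"
  shows "bounded_linear T"
proof -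
  obtain K where "\<And>x. norm (T x) \<le> K * norm x"
    using assms by (auto simp: isometry_on_def)
  moreover have "T (r *\<^sub>R x) = r *\<^sub>R T x" for r x
    using assms by (simp add: isometry_on_def flip: scaleC_of_real)
  ultimately show ?thesis
    using assms by (intro bounded_linear_intro[where K = K])
      (auto simp: isometry_on_def mult.commute)
qed

lemma bounded_linear_funpow:
  fixes T :: "'a :: real_normed_vector \<Rightarrow> 'a"
  assumes "bounded_linear T"
  shows "bounded_linear (T ^^ n)"
proof (induction n)
  case 0
  show ?case using bounded_linear_ident by (simp add: id_def)
next
  case (Suc n)
  show ?case using bounded_linear_compose[OF assms Suc] by (simp add: comp_def)
qed

lemma isometry_on_funpow_mem:
  assumes "isometry_on M T" "x \<in> M"
  shows "(T ^^ n) x \<in> M"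
  using assms by (induction n) (auto simp: isometry_on_def)

lemma isometry_on_cinner_funpow:
  assumes "isometry_on M T" "x \<in> M" "y \<in> M"
  shows "cinner ((T ^^ n) x) ((T ^^ n) y) = cinner x y"
  by (induction n)
    (use assms isometry_on_funpow_mem[OF assms(1)] in \<open>auto simp: isometry_on_def\<close>)

lemma isometry_on_zero:
  assumes "isometry_on M T" "0 \<in> M"
  shows "T 0 = 0"
proof -
  have "T (0 + 0) = T 0 + T 0"
    using assms unfolding isometry_on_def by blast
  then show ?thesis by simp
qed

text \<open>A preimage of 0 has the same inner product with itself as 0 does, hence vanishes. This
  makes the negative powers fix 0 in the bilateral case.\<close>

lemma isometry_on_inv_into_zero:
  assumes iso: "isometry_on M T" and "0 \<in> M" "T ` M = M"
  shows "inv_into M T 0 = 0"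
proof -
  have "0 \<in> T ` M" using assms by simp
  then have "inv_into M T 0 \<in> M" "T (inv_into M T 0) = 0"
    by (auto intro: inv_into_into f_inv_into_f)
  then have "cinner (inv_into M T 0) (inv_into M T 0) = 0"
    using iso unfolding isometry_on_def by (metis cinner_zero_left)
  then show ?thesis by (simp add: cinner_eq_zero_iff)
qed

lemma funpow_fixpoint: "f x = x \<Longrightarrow> (f ^^ n) x = x"
  by (induction n) auto

section \<open>Orthonormal orbits from wandering subspaces\<close>

lemma is_orth_sum_nonzero_summand:
  assumes sum: "is_orth_sum I (\<lambda>k. F k ` V) M" and "0 \<in> M" "M \<noteq> {0}"
    and F: "\<And>k. k \<in> I \<Longrightarrow> F k 0 = 0"
  obtains v where "v \<in> V" "v \<noteq> 0"
proof (cases "V \<subseteq> {0}")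
  case True
  \<comment> \<open>Every summand is now contained in \<open>{0}\<close>, so a series representing a
    point of \<open>M\<close> has only zero terms.\<close>
  have "x = 0" if "x \<in> M" for x
  proof -
    have "M = {x. \<exists>f. (\<forall>k\<in>I. f k \<in> F k ` V) \<and> (f has_sum x) I}"
      using sum by (simp add: is_orth_sum_def)
    then obtain f where f: "\<forall>k\<in>I. f k \<in> F k ` V" "(f has_sum x) I"
      using \<open>x \<in> M\<close> by auto
    with True F have "\<forall>k\<in>I. f k = 0" by fastforce
    with f(2) have "((\<lambda>_. 0) has_sum x) I"
      using has_sum_cong[of I f "\<lambda>_. 0" x] by auto
    then show "x = 0"
      using has_sum_0[of I "\<lambda>_. 0"] has_sum_unique by blast
  qed
  with assms show ?thesis by blast
qed (use that in blast)

lemma is_orth_sum_cinner_eq_0: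
  assumes "is_orth_sum I S M" "m \<in> I" "n \<in> I" "m \<noteq> n" "x \<in> S m" "y \<in> S n"
  shows "cinner x y = 0"
  using assms by (auto simp: is_orth_sum_def orthogonal_sets_def)

text \<open>Any nonzero \<open>v\<close> in the wandering subspace works, since its iterates lie in
  mutually orthogonal summands. Nonnegative powers suffice, so both kinds of shift can be treated
  alike from here on.\<close>

lemma shift_wandering_vector:
  assumes shift: "unilateral_shift_on M T \<or> bilateral_shift_on M T"
    and "0 \<in> M" "M \<noteq> {0}"
  obtains v where "v \<in> M" "v \<noteq> 0"
    and "\<And>m n. m \<noteq> n \<Longrightarrow> cinner ((T ^^ m) v) ((T ^^ n) v) = 0"
  using shift
proof
  assume "unilateral_shift_on M T"
  then obtain V where iso: "isometry_on M T" and "V \<subseteq> M"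
    and V: "is_orth_sum (UNIV :: nat set) (\<lambda>k. (T ^^ k) ` V) M"
    unfolding unilateral_shift_on_def by blast
  have "(T ^^ k) 0 = 0" for k
    using isometry_on_zero[OF iso \<open>0 \<in> M\<close>] by (rule funpow_fixpoint)
  then obtain v where "v \<in> V" "v \<noteq> 0"
    using is_orth_sum_nonzero_summand[OF V] assms by blast
  moreover have "cinner ((T ^^ m) v) ((T ^^ n) v) = 0" if "m \<noteq> n" for m n
    by (rule is_orth_sum_cinner_eq_0[OF V _ _ that]) (use \<open>v \<in> V\<close> in auto)
  ultimately show ?thesis
    using that \<open>V \<subseteq> M\<close> by blast
next
  assume "bilateral_shift_on M T"
  then obtain V where iso: "isometry_on M T" and surj: "T ` M = M" and "V \<subseteq> M"
    and V: "is_orth_sum (UNIV :: int set) (\<lambda>k. int_power_on M T k ` V) M"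
    unfolding bilateral_shift_on_def unitary_on_def by blast
  have "int_power_on M T k 0 = 0" for k
    using isometry_on_zero[OF iso \<open>0 \<in> M\<close>] isometry_on_inv_into_zero[OF iso \<open>0 \<in> M\<close> surj]
    by (simp add: int_power_on_def funpow_fixpoint)
  then obtain v where "v \<in> V" "v \<noteq> 0"
    using is_orth_sum_nonzero_summand[OF V] assms by blast
  \<comment> \<open>At the indices \<open>int m\<close> and \<open>int n\<close>,
    \<open>int_power_on\<close> is plain iteration of \<open>T\<close>.\<close>
  moreover have "cinner ((T ^^ m) v) ((T ^^ n) v) = 0" if "m \<noteq> n" for m n
    by (rule is_orth_sum_cinner_eq_0[OF V, of "int m" "int n"])
      (use that \<open>v \<in> V\<close> in \<open>auto simp: int_power_on_def\<close>)
  ultimately show ?thesis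
    using that \<open>V \<subseteq> M\<close> by blast
qed

lemma shift_orthonormal_orbit:
  assumes "unilateral_shift_on M T \<or> bilateral_shift_on M T"
    and "csubspace M" "M \<noteq> {0}"
  obtains e where "\<And>n. (T ^^ n) e \<in> M"
    and "\<And>m n. cinner ((T ^^ m) e) ((T ^^ n) e) = (if m = n then 1 else 0)"
proof -
  have iso: "isometry_on M T"
    using assms(1) unfolding unilateral_shift_on_def bilateral_shift_on_def unitary_on_def by blast
  have "0 \<in> M"
    using assms(2) by (rule complex_vector.subspace_0)
  then obtain v where v: "v \<in> M" "v \<noteq> 0"
    and orth: "\<And>m n. m \<noteq> n \<Longrightarrow> cinner ((T ^^ m) v) ((T ^^ n) v) = 0"
    using shift_wandering_vector assms by metis
  define r where "r = inverse (norm v)"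
  define e where "e = complex_of_real r *\<^sub>C v"
  have "e \<in> M"
    unfolding e_def using assms(2) v(1) by (rule complex_vector.subspace_scale)
  \<comment> \<open>\<open>T\<close> is known to be linear only on \<open>M\<close>, so the scalar
    is moved past one iterate at a time.\<close>
  have Te: "(T ^^ n) e = r *\<^sub>R (T ^^ n) v" for n
  proof (induction n)
    case 0
    show ?case by (simp add: e_def scaleC_of_real)
  next
    case (Suc n)
    have "T (complex_of_real r *\<^sub>C (T ^^ n) v) = complex_of_real r *\<^sub>C T ((T ^^ n) v)"
      using iso isometry_on_funpow_mem[OF iso v(1)] unfolding isometry_on_def by blast
    with Suc show ?case by (simp add: scaleC_of_real)
  qed
  \<comment> \<open>Conjugate symmetry makes \<open>cinner v v\<close> real, so it equals the
    squared norm.\<close>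
  have "Im (cinner v v) = 0"
    using arg_cong[OF cinner_commute[of v v], of Im] by simp
  then have vv: "cinner v v = complex_of_real ((norm v)\<^sup>2)"
    by (simp add: complex_eq_iff norm_power2_eq_cinner)
  have "cinner ((T ^^ n) e) ((T ^^ n) e) = 1" for n
    using isometry_on_cinner_funpow[OF iso v(1) v(1), of n] vv v(2)
    by (simp add: Te cinner_scaleR_left cinner_scaleR_right r_def power2_eq_square field_simps)
  moreover have "cinner ((T ^^ m) e) ((T ^^ n) e) = 0" if "m \<noteq> n" for m n
    using orth[OF that] by (simp add: Te cinner_scaleR_left cinner_scaleR_right)
  ultimately show ?thesis
    using that[of e] isometry_on_funpow_mem[OF iso \<open>e \<in> M\<close>] by simp
qed

section \<open>The projection at points of \<open>M\<close>, and limits along subsequences\<close>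

lemma orth_proj_orth_compl_eq_0:
  assumes "f \<in> M"
  shows "orth_proj (orth_compl M) f = 0"
  unfolding orth_proj_def
proof (rule the_equality)
  have "cinner f z = 0" if "z \<in> orth_compl M" for z
    using that assms by (subst cinner_commute) (simp add: orth_compl_def)
  then have f: "f \<in> orth_compl (orth_compl M)"
    by (simp add: orth_compl_def)
  then show "0 \<in> orth_compl M \<and> f - 0 \<in> orth_compl (orth_compl M)"
    by (simp add: orth_compl_def cinner_zero_left)
  fix y assume y: "y \<in> orth_compl M \<and> f - y \<in> orth_compl (orth_compl M)"
  \<comment> \<open>\<open>y\<close> lies in \<open>orth_compl M\<close>, while \<open>f\<close> and
    \<open>f - y\<close> are orthogonal to it; hence \<open>y\<close> is orthogonal to
    itself.\<close>
  then have "cinner (f - y) y = 0" "cinner f y = 0"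
    using f unfolding orth_compl_def[of "orth_compl M"] by blast+
  then show "y = 0"
    by (simp add: cinner_diff_left cinner_eq_zero_iff)
qed

lemma strict_mono_subsequence_eventually:
  fixes P :: "nat \<Rightarrow> nat \<Rightarrow> bool"
  assumes "\<And>i. eventually (P i) sequentially"
  obtains r :: "nat \<Rightarrow> nat" where "strict_mono r" "\<And>i. P i (r i)"
proof -
  have "\<exists>r. \<forall>i. P i (r i) \<and> r i < r (Suc i)"
  proof (rule dependent_nat_choice)
    show "\<exists>x. P 0 x"
      using eventually_happens[OF assms[of 0]] by auto
    show "\<exists>y. P (Suc i) y \<and> x < y" for x i
      using eventually_happens[OF eventually_conj[OF assms[of "Suc i"] eventually_gt_at_top[of x]]]
      by auto
  qed
  then show ?thesis
    using that by (auto simp: strict_mono_Suc_iff)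
qed

text \<open>Passing to a subsequence cannot increase the limsup.\<close>

lemma limsup_eq_PInfty_subsequence:
  fixes x :: "nat \<Rightarrow> real"
  assumes "strict_mono r" "filterlim (x \<circ> r) at_top sequentially"
  shows "limsup (\<lambda>n. ereal (x n)) = \<infinity>"
proof -
  have "((\<lambda>n. ereal (x n)) \<circ> r) \<longlonglongrightarrow> \<infinity>"
    using assms(2) by (simp add: tendsto_PInfty_eq_at_top comp_def)
  then have "limsup ((\<lambda>n. ereal (x n)) \<circ> r) = \<infinity>"
    by (intro lim_imp_Limsup) auto
  then show ?thesis
    using limsup_subseq_mono[OF assms(1), of "\<lambda>n. ereal (x n)"] by simp
qed

section \<open>Normalised orbit sums and their ergodic averages\<close>

definition orbit_mean :: "('a :: real_vector \<Rightarrow> 'a) \<Rightarrow> 'a \<Rightarrow> nat \<Rightarrow> 'a"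
  where "orbit_mean T e N = (1 / sqrt (real N)) *\<^sub>R (\<Sum>k<N. (T ^^ k) e)"

context
  fixes T :: "'a :: complex_hilbert_space \<Rightarrow> 'a" and e :: 'a
  assumes T: "bounded_linear T"
    and orthonormal: "\<And>m n. cinner ((T ^^ m) e) ((T ^^ n) e) = (if m = n then 1 else 0)"
begin

lemma norm_orbit_sum: "norm (\<Sum>k<N. (T ^^ k) e) = sqrt (real N)"
  by (simp add: norm_eq_sqrt_cinner cinner_sum_left cinner_sum_right orthonormal)

text \<open>The norm is 1 for positive \<open>N\<close>; for \<open>N = 0\<close> division by zero
  makes the vector 0, hence the inequality.\<close>

lemma norm_orbit_mean: "norm (orbit_mean T e N) \<le> 1"
  by (simp add: orbit_mean_def norm_orbit_sum)

lemma summable_orbit_means: "summable (\<lambda>i. (1/2) ^ i *\<^sub>R orbit_mean T e (r i))"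
proof (rule summable_comparison_test')
  show "summable (\<lambda>i. (1/2 :: real) ^ i)"
    by simp
  show "norm ((1/2) ^ i *\<^sub>R orbit_mean T e (r i)) \<le> (1/2) ^ i" if "0 \<le> i" for i
    using mult_left_mono[OF norm_orbit_mean, of "(1/2) ^ i"] by simp
qed

text \<open>
  The average is paired with \<open>\<Sum>k<2N. T\<^sup>k e\<close>, which captures all orbit coefficients of
  \<open>\<Sum>n<N. T\<^sup>n g\<^sub>N\<close>, since these have index at most \<open>2N - 2\<close>.
\<close>

lemma ergodic_average_orbit_means_ge:
  assumes "N = r j" "0 < N"
  shows "(1/2) ^ j / 2 \<le>
    norm ((1 / real N) *\<^sub>R (\<Sum>n<N. (T ^^ n) (\<Sum>i. (1/2) ^ i *\<^sub>R orbit_mean T e (r i))))"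
proof -
  define w where "w = (\<Sum>k<2*N. (T ^^ k) e)"
  \<comment> \<open>A bounded real-linear functional, so it can be applied to the series term by
    term.\<close>
  define \<phi> where "\<phi> x = Re (cinner (\<Sum>n<N. (T ^^ n) x) w)" for x
  let ?g = "\<lambda>i. (1/2) ^ i *\<^sub>R orbit_mean T e (r i)"
  have bl: "bounded_linear \<phi>"
    unfolding \<phi>_def
    by (intro bounded_linear_compose[OF bounded_linear_Re_cinner_left] bounded_linear_sum
        bounded_linear_funpow T)
  interpret \<phi>: bounded_linear \<phi> by (rule bl)
  have shift: "(T ^^ n) ((T ^^ k) e) = (T ^^ (n + k)) e" for n k
    by (simp add: funpow_add)
  \<comment> \<open>By orthonormality the pairing counts the \<open>n < N\<close> whose shifted
    index \<open>n + k\<close> still occurs in \<open>w\<close>.\<close>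
  have \<phi>_orbit: "\<phi> ((T ^^ k) e) = (\<Sum>n<N. if n + k < 2 * N then 1 else 0)" for k
    unfolding \<phi>_def w_def cinner_sum_left cinner_sum_right shift orthonormal Re_sum if_distrib[of Re]
      one_complex.sel zero_complex.sel
    by (subst sum.swap) simp
  have \<phi>_g: "\<phi> (?g i) = (1/2) ^ i * (1 / sqrt (r i)) * (\<Sum>k<r i. \<phi> ((T ^^ k) e))" for i
    by (simp add: orbit_mean_def \<phi>.scaleR \<phi>.sum)
  have "0 \<le> \<phi> ((T ^^ k) e)" for k
    unfolding \<phi>_orbit by (intro sum_nonneg) auto
  then have nonneg: "0 \<le> \<phi> (?g i)" for i
    unfolding \<phi>_g by (intro mult_nonneg_nonneg sum_nonneg) auto
  \<comment> \<open>For \<open>k < N\<close> no shifted index leaves the range of \<open>w\<close>,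
    so the count is full.\<close>
  have "\<phi> ((T ^^ k) e) = real N" if "k < N" for k
    using that unfolding \<phi>_orbit by simp
  then have "\<phi> (?g j) = (1/2) ^ j * (real N * (real N / sqrt N))"
    unfolding \<phi>_g using assms by simp
  also have "real N / sqrt N = sqrt N"
    by (simp add: real_div_sqrt)
  finally have "(1/2) ^ j * (real N * sqrt N) = \<phi> (?g j)" by simp
  \<comment> \<open>Nonnegativity allows all terms but the \<open>j\<close>-th to be
    dropped.\<close>
  also have "\<dots> \<le> (\<Sum>i. \<phi> (?g i))"
    using sum_le_suminf[of "\<lambda>i. \<phi> (?g i)" "{j}"] nonneg \<phi>.summable[OF summable_orbit_means, of r]
    by auto
  also have "\<dots> = \<phi> (\<Sum>i. ?g i)"
    by (rule \<phi>.suminf[OF summable_orbit_means, symmetric])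
  also have "\<dots> \<le> norm (\<Sum>n<N. (T ^^ n) (\<Sum>i. ?g i)) * norm w"
    unfolding \<phi>_def using Re_cinner_le_norm abs_le_D1 by blast
  \<comment> \<open>The exact value is \<open>sqrt (2 * N)\<close>; rounding it up produces the
    factor 1/2 in the conclusion.\<close>
  also have "norm w \<le> 2 * sqrt N"
    unfolding w_def norm_orbit_sum by (rule real_le_lsqrt) (simp_all add: power_mult_distrib)
  finally have "(1/2) ^ j * (real N * sqrt N) \<le>
      norm (\<Sum>n<N. (T ^^ n) (\<Sum>i. ?g i)) * (2 * sqrt N)"
    by (simp add: mult_left_mono)
  then have "(1/2) ^ j * real N \<le> norm (\<Sum>n<N. (T ^^ n) (\<Sum>i. ?g i)) * 2"
    using assms(2) by (simp add: mult.assoc[symmetric] del: power_divide)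
  then show ?thesis
    using assms(2) by (simp add: field_simps)
qed

end

text \<open>The partial sums lie in the subspace and closedness carries this to the limit. It
  ensures that the projection of the constructed \<open>f\<close> onto \<open>orth_compl M\<close>
  vanishes.\<close>

lemma csubspace_suminf_orbit_means_mem:
  fixes T :: "'a :: complex_hilbert_space \<Rightarrow> 'a"
  assumes "closed_csubspace M" "\<And>k. (T ^^ k) e \<in> M"
    and "summable (\<lambda>i. c i *\<^sub>R orbit_mean T e (r i))"
  shows "(\<Sum>i. c i *\<^sub>R orbit_mean T e (r i)) \<in> M"
proof -
  have M: "csubspace M" "closed M"
    using assms(1) by (auto simp: closed_csubspace_def)
  have scaleR: "a *\<^sub>R x \<in> M" if "x \<in> M" for a x
    using complex_vector.subspace_scale[OF M(1) that, of "complex_of_real a"]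
    by (simp add: scaleC_of_real)
  have "c i *\<^sub>R orbit_mean T e (r i) \<in> M" for i
    unfolding orbit_mean_def
    by (intro scaleR complex_vector.subspace_sum[OF M(1)] assms(2))
  then have "(\<Sum>i<n. c i *\<^sub>R orbit_mean T e (r i)) \<in> M" for n
    by (intro complex_vector.subspace_sum[OF M(1)])
  then show ?thesis
    using closed_sequentially[OF M(2) _ summable_LIMSEQ[OF assms(3)]] by simp
qed

theorem theorem1p1:
  fixes T :: "'a :: complex_hilbert_space \<Rightarrow> 'a"
    and M :: "'a set"
    and \<epsilon> :: "nat \<Rightarrow> real"
  assumes "separable_space (euclidean :: 'a topology)"
    and "isometry_on UNIV T"
    and "closed_csubspace M"
    and "M \<noteq> {0}"
    and "(UNIV :: 'a set) = {g + h |g h. g \<in> M \<and> h \<in> orth_compl M}"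
    and "unilateral_shift_on M T \<or> bilateral_shift_on M T"
    and "\<forall>x\<in>orth_compl M. T x = x"
    and "\<forall>n. 0 < \<epsilon> n"
    and "\<epsilon> \<longlonglongrightarrow> 0"
  shows "\<exists>f :: 'a.
    limsup (\<lambda>N. ereal (inverse (\<epsilon> N) *
      norm ((1 / real N) *\<^sub>R (\<Sum>n<N. (T ^^ n) f) - orth_proj (orth_compl M) f))) = \<infinity>"
proof -
  have M: "csubspace M"
    using assms(3) by (simp add: closed_csubspace_def)
  obtain e where e: "\<And>n. (T ^^ n) e \<in> M"
    and orthonormal: "\<And>m n. cinner ((T ^^ m) e) ((T ^^ n) e) = (if m = n then 1 else 0)"
    using shift_orthonormal_orbit[OF assms(6) M assms(4)] by metis
  have T: "bounded_linear T"
    using assms(2) by (rule isometry_on_bounded_linear)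
  \<comment> \<open>The base 1/4 is chosen so that \<open>inverse (\<epsilon> (r i))\<close>
    outgrows the lower bound \<open>(1/2) ^ i / 2\<close> for the averages, leaving
    \<open>2 ^ i / 2\<close>.\<close>
  have "eventually (\<lambda>N. 0 < N \<and> \<epsilon> N \<le> (1/4) ^ i) sequentially" for i
    using order_tendstoD(2)[OF assms(9), of "(1/4) ^ i"]
    by (intro eventually_conj eventually_gt_at_top) (auto elim: eventually_mono)
  then obtain r where r: "strict_mono r" "\<And>i. 0 < r i \<and> \<epsilon> (r i) \<le> (1/4) ^ i"
    using strict_mono_subsequence_eventually[of "\<lambda>i N. 0 < N \<and> \<epsilon> N \<le> (1/4) ^ i"] by metis
  define f where "f = (\<Sum>i. (1/2) ^ i *\<^sub>R orbit_mean T e (r i))"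
  define x where "x N = inverse (\<epsilon> N) *
    norm ((1 / real N) *\<^sub>R (\<Sum>n<N. (T ^^ n) f) - orth_proj (orth_compl M) f)" for N
  have "f \<in> M"
    unfolding f_def using assms(3) e summable_orbit_means[OF T orthonormal]
    by (rule csubspace_suminf_orbit_means_mem)
  have "2 ^ i / 2 \<le> (x \<circ> r) i" for i
  proof -
    have "4 ^ i \<le> inverse (\<epsilon> (r i))"
      using le_imp_inverse_le[of "\<epsilon> (r i)" "(1/4) ^ i"] r(2)[of i] assms(8)
      by (simp add: power_divide)
    moreover have "(1/2) ^ i / 2 \<le> norm ((1 / real (r i)) *\<^sub>R (\<Sum>n<r i. (T ^^ n) f))"
      unfolding f_def
      using ergodic_average_orbit_means_ge[OF T orthonormal, of "r i" r i] r(2)[of i] by simp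
    ultimately have "4 ^ i * ((1/2) ^ i / 2) \<le> (x \<circ> r) i"
      unfolding x_def comp_def orth_proj_orth_compl_eq_0[OF \<open>f \<in> M\<close>] diff_zero
      by (intro mult_mono) (use assms(8) in \<open>auto simp: less_imp_le\<close>)
    moreover have "(4 :: real) ^ i * (1/2) ^ i = 2 ^ i"
      by (simp flip: power_mult_distrib)
    ultimately show ?thesis by simp
  qed
  moreover have "filterlim (\<lambda>i. 2 ^ i / 2 :: real) at_top sequentially"
    by real_asymp
  ultimately have "filterlim (x \<circ> r) at_top sequentially"
    by (auto intro: filterlim_at_top_mono)
  then have "limsup (\<lambda>N. ereal (x N)) = \<infinity>"
    by (rule limsup_eq_PInfty_subsequence[OF r(1)])
  then show ?thesis
    unfolding x_def by blast
qed

end
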